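(* Let $D_1$ and $D_2$ be two digraphs on $n_1$ and $n_2$ vertices, and $m_1$ and $m_2$ arcs, respectively. Then $$f_{A(D_1\odot D_2)}(\lambda)=\lambda^{m_1-n_1}\left[f_{A(D_2)}(\lambda)\right]^{n_1} f_{A(D_1)}\left(\lambda^2-\lambda\, \chi_{A(D_2)}(\lambda)\right).$$ In particular, the $A$-spectrum of $D_1\odot D_2$ is completely determined by the $A$-spectra of $D_1$ and $D_2$, and the $A$-coronal of $D_2$.
   Context: All digraphs are nonempty and simple (no loops, no multiple arcs), but both arcs $uv$ and $vu$ may be present. The adjacency matrix $A(D)=[a_{ij}]$ of a digraph $D$ with vertices $v_1,\dots,v_n$ has $a_{ij}=1$ if $v_iv_j$ is an arc and $a_{ij}=0$ otherwise. For an $n\times n$ real matrix $M$, $f_M(\lambda)=\det(\lambda I_n-M)$ is its characteristic polynomial and its coronal is $\chi_M(\lambda)=\mathbf 1_n^T(\lambda I_n-M)^{-1}\mathbf 1_n\in\mathbb C(\lambda)$, where $\mathbf 1_n$ is the all-ones column vector. The $A$-spectrum of $D$ consists of the roots of $f_{A(D)}$, and the $A$-coronal of $D$ is $\chi_{A(D)}$. The subdivision digraph $\mathcal S(D)$ is obtained from $D$ by replacing each arc $uv$ by a directed path $u\to w\to v$ of length two through a new vertex $w$ (one new vertex per arc). The (symmetric) subdivision-vertex corona $D_1\odot D_2$ is obtained by taking $\mathcal S(D_1)$ and $n_1=|V(D_1)|$ copies of $D_2$ (all vertex-disjoint), one copy $D_2^{(v)}$ for each original vertex $v\in V(D_1)$,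 and adding, for every $v\in V(D_1)$, both arcs $vw$ and $wv$ for all $w\in V(D_2^{(v)})$.
   Formalization: The full A-spectrum is shown to be determined only when the number m_1 of arcs of D_1 is also given (without it the claim fails, e.g. two isolated vertices versus one arc, with D_2 = K_1); without m_1, the nonzero eigenvalues with multiplicities are determined. *)

theory Defs
  imports
    Graph_Theory.Pair_Digraph
    Jordan_Normal_Form.Char_Poly
    Jordan_Normal_Form.Gauss_Jordan_Elimination
    "HOL-Computational_Algebra.Computational_Algebra"
begin

text \<open>
  A finite simple digraph is a \<^locale>\<open>pair_digraph\<close>: its arcs are ordered pairs of distinct
  vertices, so there are no loops and no multiple arcs, but \<open>(u, v)\<close> and \<open>(v, u)\<close> may both be arcs.
\<close>

definition nonempty_digraph :: "'a pair_pre_digraph \<Rightarrow> bool" where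
  "nonempty_digraph D \<longleftrightarrow> pair_digraph D \<and> pverts D \<noteq> {}"

text \<open>
  The adjacency matrix is taken with respect to an explicit enumeration of the vertices. It is
  0/1-valued, and regarded as a complex matrix since its spectrum is complex.
\<close>

definition vertex_enum :: "'a pair_pre_digraph \<Rightarrow> 'a list \<Rightarrow> bool" where
  "vertex_enum D vs \<longleftrightarrow> distinct vs \<and> set vs = pverts D"

definition adjacency_matrix :: "'a pair_pre_digraph \<Rightarrow> 'a list \<Rightarrow> complex mat" where
  "adjacency_matrix D vs =
     mat (length vs) (length vs) (\<lambda>(i, j). if (vs ! i, vs ! j) \<in> parcs D then 1 else 0)"

text \<open>
  The field of rational functions in one indeterminate over the complex numbers is
  \<^typ>\<open>complex poly fract\<close>; \<open>\<Lambda>\<close> is its indeterminate.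
\<close>

definition ratfun_const :: "complex \<Rightarrow> complex poly fract" where
  "ratfun_const c = to_fract [:c:]"

definition ratfun_var :: "complex poly fract" (\<open>\<Lambda>\<close>) where
  "\<Lambda> = to_fract [:0, 1:]"

definition poly_subst :: "complex poly \<Rightarrow> complex poly fract \<Rightarrow> complex poly fract" where
  "poly_subst p r = poly (map_poly ratfun_const p) r"

definition coronal :: "complex mat \<Rightarrow> complex poly fract" where
  "coronal M =
     (let n = dim_row M;
          R = the (mat_inverse (\<Lambda> \<cdot>\<^sub>m 1\<^sub>m n - map_mat ratfun_const M));
          u = vec n (\<lambda>_. 1)
      in u \<bullet> (R *\<^sub>v u))"

text \<open>
  The spectrum is the multiset of roots of the characteristic polynomial, with multiplicities.
\<close>

definition A_spectrum :: "'a pair_pre_digraph \<Rightarrow> 'a list \<Rightarrow> complex multiset" where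
  "A_spectrum D vs = proots (char_poly (adjacency_matrix D vs))"

datatype 'a subdiv_vertex = Orig 'a | Mid "'a \<times> 'a"

definition subdivision_digraph :: "'a pair_pre_digraph \<Rightarrow> 'a subdiv_vertex pair_pre_digraph" where
  "subdivision_digraph D =
     \<lparr> pverts = Orig ` pverts D \<union> Mid ` parcs D,
       parcs = {(Orig u, Mid (u, v)) | u v. (u, v) \<in> parcs D}
             \<union> {(Mid (u, v), Orig v) | u v. (u, v) \<in> parcs D} \<rparr>"

text \<open>\<open>Copy v w\<close> is the vertex \<open>w\<close> in the copy of the second digraph that is attached to \<open>v\<close>.\<close>

datatype ('a, 'b) corona_vertex = Sub "'a subdiv_vertex" | Copy 'a 'b

definition subdivision_vertex_corona ::
  "'a pair_pre_digraph \<Rightarrow> 'b pair_pre_digraph \<Rightarrow> ('a, 'b) corona_vertex pair_pre_digraph"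
  (infixl \<open>\<odot>\<close> 70) where
  "D1 \<odot> D2 =
     \<lparr> pverts = Sub ` pverts (subdivision_digraph D1)
              \<union> {Copy v w | v w. v \<in> pverts D1 \<and> w \<in> pverts D2},
       parcs = {(Sub x, Sub y) | x y. (x, y) \<in> parcs (subdivision_digraph D1)}
             \<union> {(Copy v w, Copy v w') | v w w'. v \<in> pverts D1 \<and> (w, w') \<in> parcs D2}
             \<union> {(Sub (Orig v), Copy v w) | v w. v \<in> pverts D1 \<and> w \<in> pverts D2}
             \<union> {(Copy v w, Sub (Orig v)) | v w. v \<in> pverts D1 \<and> w \<in> pverts D2} \<rparr>"

end

theory Submission
  imports Defs
begin

text \<open>
  Order the vertices of the corona as the original vertices of the first digraph followed by all
  other vertices, that is, the subdivision vertices and the copies of the second digraph. Two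
  vertices of the second group are joined by an arc only if they lie in the same copy, so the block
  of \<open>\<Lambda> I - A\<close> that belongs to this group is block diagonal, and its determinant is
  \<open>\<Lambda>\<close> to the number of arcs \<open>m\<^sub>1\<close> times the characteristic polynomial of \<open>D\<^sub>2\<close> to the power
  \<open>n\<^sub>1\<close>. It remains to find the Schur complement of this block. Two original vertices are never
  adjacent, so that the first diagonal block is just \<open>\<Lambda> I\<close>. Eliminating the subdivision vertices
  subtracts \<open>1 / \<Lambda>\<close> at \<open>(u, v)\<close> for each arc \<open>(u, v)\<close>, because this arc gives the only path of
  length two from \<open>u\<close> to \<open>v\<close> through a subdivision vertex. Eliminating the copy at \<open>v\<close>, which
  is joined to \<open>v\<close> in both directions by all-ones vectors, subtracts the coronal \<open>\<chi>\<close> of \<open>D\<^sub>2\<close> at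
  \<open>(v, v)\<close>. The Schur complement is therefore
  \<open>(\<Lambda> - \<chi>) I - A(D\<^sub>1) / \<Lambda> = (1 / \<Lambda>) ((\<Lambda>\<^sup>2 - \<Lambda> \<chi>) I - A(D\<^sub>1))\<close>,
  and its determinant is \<open>\<Lambda>\<close> to the power \<open>- n\<^sub>1\<close> times the characteristic polynomial of \<open>D\<^sub>1\<close>
  at \<open>\<Lambda>\<^sup>2 - \<Lambda> \<chi>\<close>.

  The inverse of the second block need not be described: \<open>det_table_mat_schur\<close> asks only for a
  solution of its linear system, one column for each original vertex. On a copy, this is the solution \<open>x\<close> of
  \<open>(\<Lambda> I - A(D\<^sub>2)) x = 1\<close> from \<open>coronal_solution\<close>, whose entries sum to \<open>\<chi>\<close>. The computation
  itself is \<open>char_poly_corona\<close>.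

  The claim on spectra follows because a monic complex polynomial is the product of the linear
  factors of its roots. Equal data on the right-hand side thus give characteristic polynomials of
  the two coronas that agree up to a power of \<open>\<Lambda>\<close>, the exponent being the difference of the
  numbers of arcs. The spectra do not determine the number of arcs, so the multiplicity of the
  eigenvalue 0 may differ if the arc counts do.
\<close>

section \<open>Determinants of tables indexed by lists\<close>

text \<open>
  Rows and columns are labelled by lists of vertices, so that entries and sums can be
  written in terms of vertices, and the index arithmetic of nested blocks is absorbed by list
  concatenation.
\<close>

definition table_mat :: "('v \<Rightarrow> 'w \<Rightarrow> 'k) \<Rightarrow> 'v list \<Rightarrow> 'w list \<Rightarrow> 'k mat" where
  "table_mat M xs ys = mat (length xs) (length ys) (\<lambda>(i, j). M (xs ! i) (ys ! j))"

lemma table_mat_carrier [simp]: "table_mat M xs ys \<in> carrier_mat (length xs) (length ys)"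
  by (simp add: table_mat_def)

lemma dim_table_mat [simp]:
  "dim_row (table_mat M xs ys) = length xs" "dim_col (table_mat M xs ys) = length ys"
  by (simp_all add: table_mat_def)

lemma index_table_mat [simp]:
  "i < length xs \<Longrightarrow> j < length ys \<Longrightarrow> table_mat M xs ys $$ (i, j) = M (xs ! i) (ys ! j)"
  by (simp add: table_mat_def)

lemma table_mat_map: "table_mat M (map f xs) (map g ys) = table_mat (\<lambda>x y. M (f x) (g y)) xs ys"
  by (rule eq_matI) auto

lemma table_mat_cong:
  assumes "\<And>x y. x \<in> set xs \<Longrightarrow> y \<in> set ys \<Longrightarrow> M x y = N x y"
  shows "table_mat M xs ys = table_mat N xs ys"
  by (rule eq_matI) (auto simp: assms)

lemma sum_set_conv_nth:
  assumes "distinct xs"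
  shows "(\<Sum>x\<in>set xs. f x) = (\<Sum>i = 0..<length xs. f (xs ! i))"
  using sum.reindex_bij_betw[OF bij_betw_nth[OF assms, of "{0..<length xs}"], of "set xs" f]
  by (simp add: atLeast0LessThan)

lemma table_mat_mult:
  assumes "distinct ys"
  shows "table_mat M xs ys * table_mat N ys zs = table_mat (\<lambda>x z. \<Sum>y\<in>set ys. M x y * N y z) xs zs"
  by (rule eq_matI) (auto simp: sum_set_conv_nth[OF assms] scalar_prod_def intro!: sum.cong)

lemma table_mat_append:
  "table_mat M (xs @ ys) (xs' @ ys') =
     four_block_mat (table_mat M xs xs') (table_mat M xs ys')
                    (table_mat M ys xs') (table_mat M ys ys')"
  by (rule eq_matI) (auto simp: nth_append)

text \<open>
  Two enumerations of the same set differ by a permutation. It is applied to the rows and, after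
  transposing, to the columns, and its sign cancels.
\<close>

lemma det_table_mat_reorder:
  fixes M :: "'v \<Rightarrow> 'v \<Rightarrow> 'k :: comm_ring_1"
  assumes "distinct xs" "distinct ys" "set xs = set ys"
  shows "det (table_mat M xs xs) = det (table_mat M ys ys)"
proof -
  have "mset xs = mset ys"
    using assms by (simp add: set_eq_iff_mset_eq_distinct)
  then obtain p where p: "p permutes {..<length ys}" and xs: "permute_list p ys = xs"
    by (metis mset_eq_permutation)
  define n where "n = length ys"
  have len: "length xs = n"
    using xs by (auto simp: n_def)
  have p': "p permutes {0..<n}"
    using p by (simp add: n_def atLeast0LessThan)
  have lt: "p i < n" if "i < n" for i
    using permutes_in_image[OF p', of i] that by auto
  have nth: "xs ! i = ys ! p i" if "i < n" for i
    using that xs permute_list_nth[OF p] by (auto simp: n_def)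
  \<comment> \<open>only the rows are reordered in \<open>B\<close>\<close>
  define B where "B = table_mat M xs ys"
  have B: "B \<in> carrier_mat n n"
    by (simp add: B_def n_def len[symmetric] table_mat_def) (simp add: len n_def)
  have "B = mat n n (\<lambda>(i, j). table_mat M ys ys $$ (p i, j))"
    by (rule eq_matI) (auto simp: B_def n_def[symmetric] len nth lt)
  then have 1: "det B = signof p * det (table_mat M ys ys)"
    using det_permute_rows[OF _ p', of "table_mat M ys ys"] by (simp add: n_def)
  have "transpose_mat (table_mat M xs xs) = mat n n (\<lambda>(i, j). transpose_mat B $$ (p i, j))"
    by (rule eq_matI) (auto simp: B_def n_def[symmetric] len nth lt)
  then have "det (transpose_mat (table_mat M xs xs)) = signof p * det (transpose_mat B)"
    using det_permute_rows[OF _ p', of "transpose_mat B"] B by simp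
  then have 2: "det (table_mat M xs xs) = signof p * det B"
    using det_transpose[OF table_mat_carrier[of M xs xs]] det_transpose[OF B] by simp
  show ?thesis
    unfolding 2 1 by (simp add: sign_def)
qed

lemma det_table_mat_append:
  fixes M :: "'v \<Rightarrow> 'v \<Rightarrow> 'k :: idom"
  assumes "\<And>x y. x \<in> set xs \<Longrightarrow> y \<in> set ys \<Longrightarrow> M y x = 0"
  shows "det (table_mat M (xs @ ys) (xs @ ys)) = det (table_mat M xs xs) * det (table_mat M ys ys)"
proof -
  have "table_mat M ys xs = 0\<^sub>m (length ys) (length xs)"
    by (rule eq_matI) (auto simp: assms)
  then show ?thesis
    unfolding table_mat_append
    by (intro det_four_block_mat_lower_left_zero[of _ "length xs" _ "length ys"]) auto
qed

lemma det_table_mat_concat: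
  fixes M :: "'v \<Rightarrow> 'v \<Rightarrow> 'k :: idom"
  assumes "distinct us"
    and "\<And>u v x y. \<lbrakk>u \<in> set us; v \<in> set us; u \<noteq> v; x \<in> set (F u); y \<in> set (F v)\<rbrakk> \<Longrightarrow> M x y = 0"
  shows "det (table_mat M (concat (map F us)) (concat (map F us))) =
         (\<Prod>u\<leftarrow>us. det (table_mat M (F u) (F u)))"
  using assms
proof (induction us)
  case Nil
  then show ?case by (simp add: det_def table_mat_def)
next
  case (Cons u us)
  have "det (table_mat M (concat (map F us)) (concat (map F us))) =
        (\<Prod>u\<leftarrow>us. det (table_mat M (F u) (F u)))"
    by (rule Cons.IH) (use Cons.prems in auto)
  moreover have "M y x = 0" if "x \<in> set (F u)" "y \<in> set (concat (map F us))" for x y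
  proof -
    obtain v where "v \<in> set us" "y \<in> set (F v)"
      using \<open>y \<in> _\<close> by auto
    with Cons.prems(1) show ?thesis
      by (intro Cons.prems(2)[of v u]) (use that in auto)
  qed
  then have "det (table_mat M (F u @ concat (map F us)) (F u @ concat (map F us))) =
      det (table_mat M (F u) (F u)) * det (table_mat M (concat (map F us)) (concat (map F us)))"
    by (rule det_table_mat_append)
  ultimately show ?case
    by simp
qed

text \<open>
  Let \<open>A B C D\<close> be the four blocks of the table. The hypothesis says \<open>D X = C\<close>, so multiplying from
  the right by the block matrix with rows \<open>1, 0\<close> and \<open>- X, 1\<close>, which has determinant 1, replaces \<open>A\<close>
  by \<open>A - B X\<close> and \<open>C\<close> by \<open>0\<close>. If \<open>D\<close> is invertible, this is the Schur complement formula.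
\<close>

lemma det_table_mat_schur:
  fixes M :: "'v \<Rightarrow> 'v \<Rightarrow> 'k :: idom"
  assumes dist: "distinct ys"
    and X: "\<And>y v. y \<in> set ys \<Longrightarrow> v \<in> set xs \<Longrightarrow> (\<Sum>s\<in>set ys. M y s * X s v) = M y v"
  shows "det (table_mat M (xs @ ys) (xs @ ys)) =
         det (table_mat (\<lambda>u v. M u v - (\<Sum>s\<in>set ys. M u s * X s v)) xs xs) * det (table_mat M ys ys)"
proof -
  let ?n = "length xs" and ?m = "length ys"
  let ?S = "\<lambda>u v. M u v - (\<Sum>s\<in>set ys. M u s * X s v)"
  let ?A = "table_mat M xs xs" and ?B = "table_mat M xs ys"
  let ?C = "table_mat M ys xs" and ?D = "table_mat M ys ys"
  define Y where "Y = table_mat (\<lambda>s v. - X s v) ys xs"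
  define E where "E = four_block_mat (1\<^sub>m ?n) (0\<^sub>m ?n ?m) Y (1\<^sub>m ?m)"
  have Y: "Y \<in> carrier_mat ?m ?n"
    by (simp add: Y_def)
  have "?A + ?B * Y = table_mat ?S xs xs"
    unfolding Y_def table_mat_mult[OF dist] by (rule eq_matI) (auto simp: sum_negf)
  moreover have "?C + ?D * Y = 0\<^sub>m ?m ?n"
    unfolding Y_def table_mat_mult[OF dist] by (rule eq_matI) (auto simp: sum_negf X)
  moreover have "?A * 1\<^sub>m ?n = ?A" "?C * 1\<^sub>m ?n = ?C" "?B * 1\<^sub>m ?m = ?B" "?D * 1\<^sub>m ?m = ?D"
    "?A * 0\<^sub>m ?n ?m = 0\<^sub>m ?n ?m" "?C * 0\<^sub>m ?n ?m = 0\<^sub>m ?m ?m"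
    by (auto intro!: right_mult_one_mat right_mult_zero_mat)
  ultimately have "table_mat M (xs @ ys) (xs @ ys) * E =
      four_block_mat (table_mat ?S xs xs) ?B (0\<^sub>m ?m ?n) ?D"
    unfolding table_mat_append E_def
    by (subst mult_four_block_mat[of _ ?n ?n _ ?m _ ?m _ _ ?n _ ?m])
      (use Y in \<open>auto simp: left_add_zero_mat\<close>)
  then have "det (table_mat M (xs @ ys) (xs @ ys) * E) = det (table_mat ?S xs xs) * det ?D"
    using det_four_block_mat_lower_left_zero[of "table_mat ?S xs xs" ?n ?B ?m "0\<^sub>m ?m ?n" ?D] by simp
  moreover have "det E = 1"
    unfolding E_def using det_four_block_mat_upper_right_zero[of "1\<^sub>m ?n" ?n "0\<^sub>m ?n ?m" ?m Y "1\<^sub>m ?m"] Y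
    by simp
  moreover have "E \<in> carrier_mat (length (xs @ ys)) (length (xs @ ys))"
    unfolding E_def using Y by auto
  ultimately show ?thesis
    using det_mult[OF table_mat_carrier[of M "xs @ ys" "xs @ ys"], of E] by simp
qed

section \<open>The characteristic polynomial over the rational functions\<close>

lemma ratfun_const_hom: "comm_ring_hom ratfun_const"
  by unfold_locales (simp_all add: ratfun_const_def to_fract_add[symmetric] to_fract_mult[symmetric] pCons_one)

lemma poly_subst_hom: "comm_ring_hom (\<lambda>p. poly_subst p r)"
proof -
  interpret c: comm_ring_hom ratfun_const by (rule ratfun_const_hom)
  interpret cm: map_poly_comm_ring_hom ratfun_const ..
  show ?thesis
    by unfold_locales (simp_all add: poly_subst_def hom_distribs)
qed

lemma poly_subst_var: "poly_subst p \<Lambda> = to_fract p"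
proof (induction p)
  case 0
  then show ?case by (simp add: poly_subst_def)
next
  case (pCons a p)
  interpret c: comm_ring_hom ratfun_const by (rule ratfun_const_hom)
  have "poly_subst (pCons a p) \<Lambda> = ratfun_const a + \<Lambda> * to_fract p"
    using pCons by (simp add: poly_subst_def c.map_poly_pCons_hom)
  also have "\<dots> = to_fract (pCons a p)"
    by (simp add: ratfun_const_def ratfun_var_def flip: to_fract_add to_fract_mult)
  finally show ?case .
qed

text \<open>
  The matrix \<open>r I - A(D)\<close> as a function of two vertices. It is used with \<open>r = \<Lambda>\<close> for the
  corona and \<open>D\<^sub>2\<close>, and with the argument of the substitution for \<open>D\<^sub>1\<close>.
\<close>

definition pencil :: "complex poly fract \<Rightarrow> 'v pair_pre_digraph \<Rightarrow> 'v \<Rightarrow> 'v \<Rightarrow> complex poly fract" where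
  "pencil r D x y = (if x = y then r else 0) - (if (x, y) \<in> parcs D then 1 else 0)"

lemma adjacency_matrix_carrier [simp]:
  "adjacency_matrix D vs \<in> carrier_mat (length vs) (length vs)"
  by (simp add: adjacency_matrix_def)

lemma table_mat_pencil:
  assumes "distinct vs"
  shows "table_mat (pencil r D) vs vs =
         r \<cdot>\<^sub>m 1\<^sub>m (length vs) - map_mat ratfun_const (adjacency_matrix D vs)"
proof -
  interpret c: comm_ring_hom ratfun_const by (rule ratfun_const_hom)
  show ?thesis
    by (rule eq_matI) (auto simp: pencil_def adjacency_matrix_def nth_eq_iff_index_eq[OF assms])
qed

text \<open>
  Substitution is a ring homomorphism and hence commutes with the determinant. For \<open>r = \<Lambda>\<close> the
  left-hand side is the embedded characteristic polynomial, by \<open>poly_subst_var\<close>.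
\<close>

lemma poly_subst_char_poly:
  assumes "distinct vs"
  shows "poly_subst (char_poly (adjacency_matrix D vs)) r = det (table_mat (pencil r D) vs vs)"
proof -
  interpret c: comm_ring_hom ratfun_const by (rule ratfun_const_hom)
  interpret s: comm_ring_hom "\<lambda>p. poly_subst p r" by (rule poly_subst_hom)
  let ?A = "adjacency_matrix D vs"
  have *: "poly_subst (pCons c 1) r = r + ratfun_const c" "poly_subst [:c:] r = ratfun_const c" for c
    by (simp_all add: poly_subst_def c.map_poly_pCons_hom)
  have "map_mat (\<lambda>p. poly_subst p r) (char_poly_matrix ?A) = table_mat (pencil r D) vs vs"
    unfolding table_mat_pencil[OF assms]
    by (rule eq_matI) (auto simp: char_poly_matrix_def adjacency_matrix_def s.hom_add s.hom_mult s.hom_zero s.hom_one * c.hom_uminus c.hom_zero c.hom_one)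
  then show ?thesis
    by (simp add: char_poly_def flip: s.hom_det)
qed

lemma char_poly_nz: "char_poly (adjacency_matrix D vs) \<noteq> 0"
  using degree_monic_char_poly[OF adjacency_matrix_carrier[of D vs]] by auto

text \<open>
  The solution is the vector of row sums of \<open>(\<Lambda> I - A)\<close> inverse, read as a function on vertices.
  The inverse exists since the characteristic polynomial, being monic, is a nonzero element of the
  field of rational functions.
\<close>

lemma coronal_solution:
  assumes dist: "distinct vs"
  obtains x where "\<And>w. w \<in> set vs \<Longrightarrow> (\<Sum>w'\<in>set vs. pencil \<Lambda> D w w' * x w') = 1"
    and "(\<Sum>w\<in>set vs. x w) = coronal (adjacency_matrix D vs)"
proof -
  let ?n = "length vs" and ?P = "table_mat (pencil \<Lambda> D) vs vs"
  have "det ?P = to_fract (char_poly (adjacency_matrix D vs))"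
    using poly_subst_char_poly[OF dist] by (metis poly_subst_var)
  then have "det ?P \<noteq> 0"
    using char_poly_nz[of D vs] by simp
  then obtain R where R: "mat_inverse ?P = Some R"
    using det_non_zero_imp_unit[OF table_mat_carrier[of "pencil \<Lambda> D" vs vs], where b = "()"]
      mat_inverse(1)[OF table_mat_carrier[of "pencil \<Lambda> D" vs vs], where b = "()"]
    by (metis not_None_eq)
  have inv: "?P * R = 1\<^sub>m ?n" and carr: "R \<in> carrier_mat ?n ?n"
    using mat_inverse(2)[OF table_mat_carrier R] by auto
  define u :: "complex poly fract vec" where "u = vec ?n (\<lambda>_. 1)"
  define z where "z = R *\<^sub>v u"
  have z: "z \<in> carrier_vec ?n"
    using carr by (simp add: z_def u_def)
  have u: "u \<in> carrier_vec ?n"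
    by (simp add: u_def)
  have Pz: "?P *\<^sub>v z = u"
    unfolding z_def using assoc_mult_mat_vec[OF table_mat_carrier carr u, of "pencil \<Lambda> D" vs] u
    by (simp add: inv)
  have cor: "coronal (adjacency_matrix D vs) = u \<bullet> z"
    using R unfolding coronal_def table_mat_pencil[OF dist]
    by (simp add: adjacency_matrix_def u_def z_def Let_def)
  \<comment> \<open>\<open>x\<close> looks up the coordinate of \<open>z\<close> at the position of a vertex\<close>
  define x where "x w = z $ (inv_into {0..<?n} ((!) vs) w)" for w
  have x: "x (vs ! i) = z $ i" if "i < ?n" for i
    using that dist by (simp add: x_def inv_into_f_f inj_on_nth)
  show ?thesis
  proof (rule that)
    show "(\<Sum>w\<in>set vs. x w) = coronal (adjacency_matrix D vs)"
      using z unfolding cor by (simp add: sum_set_conv_nth[OF dist] x u_def scalar_prod_def)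
  next
    fix w assume "w \<in> set vs"
    then obtain i where i: "i < ?n" "w = vs ! i"
      by (auto simp: in_set_conv_nth)
    have "(?P *\<^sub>v z) $ i = 1"
      using i by (simp add: Pz u_def)
    then show "(\<Sum>w'\<in>set vs. pencil \<Lambda> D w w' * x w') = 1"
      using i z by (simp add: sum_set_conv_nth[OF dist] x scalar_prod_def)
  qed
qed

section \<open>The characteristic polynomial of the corona\<close>

lemma corona_arc_iff [simp]:
  "(Sub (Orig u), Sub (Orig v)) \<notin> parcs (D1 \<odot> D2)"
  "(Sub (Mid a), Sub (Mid b)) \<notin> parcs (D1 \<odot> D2)"
  "(Sub (Orig u), Sub (Mid a)) \<in> parcs (D1 \<odot> D2) \<longleftrightarrow> a \<in> parcs D1 \<and> fst a = u"
  "(Sub (Mid a), Sub (Orig v)) \<in> parcs (D1 \<odot> D2) \<longleftrightarrow> a \<in> parcs D1 \<and> snd a = v"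
  "(Copy v w, Copy v' w') \<in> parcs (D1 \<odot> D2) \<longleftrightarrow> v = v' \<and> v \<in> pverts D1 \<and> (w, w') \<in> parcs D2"
  "(Sub (Orig u), Copy v w) \<in> parcs (D1 \<odot> D2) \<longleftrightarrow> u = v \<and> v \<in> pverts D1 \<and> w \<in> pverts D2"
  "(Copy v w, Sub (Orig u)) \<in> parcs (D1 \<odot> D2) \<longleftrightarrow> u = v \<and> v \<in> pverts D1 \<and> w \<in> pverts D2"
  "(Sub (Mid a), Copy v w) \<notin> parcs (D1 \<odot> D2)"
  "(Copy v w, Sub (Mid a)) \<notin> parcs (D1 \<odot> D2)"
  by (cases a; cases b; auto simp: subdivision_vertex_corona_def subdivision_digraph_def)+

lemma ratfun_var_nz [simp]: "\<Lambda> \<noteq> 0"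
  by (simp add: ratfun_var_def)

text \<open>
  The power of \<open>\<Lambda>\<close> that comes from the factor \<open>1 / \<Lambda>\<close> of the Schur complement is kept on the
  left to avoid a negative exponent; in this form the equation can be compared for two coronas by
  cancelling it.
\<close>

lemma char_poly_corona:
  fixes D1 :: "'a pair_pre_digraph" and D2 :: "'b pair_pre_digraph"
  assumes fin: "finite (parcs D1)"
    and vs1: "vertex_enum D1 vs1" and vs2: "vertex_enum D2 vs2" and vs: "vertex_enum (D1 \<odot> D2) vs"
  shows "\<Lambda> ^ card (pverts D1) * to_fract (char_poly (adjacency_matrix (D1 \<odot> D2) vs)) =
       \<Lambda> ^ card (parcs D1)
       * to_fract (char_poly (adjacency_matrix D2 vs2)) ^ card (pverts D1)
       * poly_subst (char_poly (adjacency_matrix D1 vs1))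
           (\<Lambda> ^ 2 - \<Lambda> * coronal (adjacency_matrix D2 vs2))"
proof -
  have d1: "distinct vs1" "set vs1 = pverts D1" and d2: "distinct vs2" "set vs2 = pverts D2"
    and d: "distinct vs" "set vs = pverts (D1 \<odot> D2)"
    using vs1 vs2 vs by (auto simp: vertex_enum_def)
  have len: "length vs1 = card (pverts D1)"
    using d1 distinct_card by fastforce
  obtain as where as: "distinct as" "set as = parcs D1"
    using finite_distinct_list[OF fin] by auto
  have lena: "length as = card (parcs D1)"
    using as distinct_card by fastforce
  define xs :: "('a, 'b) corona_vertex list" where "xs = map (\<lambda>v. Sub (Orig v)) vs1"
  \<comment> \<open>singleton blocks, so that \<open>det_table_mat_concat\<close> covers the subdivision vertices as well\<close>
  define ms :: "('a, 'b) corona_vertex list" where "ms = concat (map (\<lambda>a. [Sub (Mid a)]) as)"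
  define cs where "cs = concat (map (\<lambda>v. map (Copy v) vs2) vs1)"
  define P where "P = pencil \<Lambda> (D1 \<odot> D2)"
  define \<chi> where "\<chi> = coronal (adjacency_matrix D2 vs2)"
  obtain x where x1: "\<And>w. w \<in> set vs2 \<Longrightarrow> (\<Sum>w'\<in>set vs2. pencil \<Lambda> D2 w w' * x w') = 1"
    and x2: "(\<Sum>w\<in>set vs2. x w) = \<chi>"
    using coronal_solution[OF d2(1)] unfolding \<chi>_def by blast
  have ms': "ms = map (\<lambda>a. Sub (Mid a)) as"
    unfolding ms_def by (induction as) auto
  have dms: "distinct ms" and sms: "set ms = (\<lambda>a. Sub (Mid a)) ` parcs D1"
    unfolding ms' using as by (auto simp: distinct_map inj_on_def)
  have scs: "set cs = (\<lambda>(v, w). Copy v w) ` (pverts D1 \<times> pverts D2)"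
    unfolding cs_def by (auto simp: d1 d2)
  have dcs: "distinct cs"
  proof -
    have "cs = map (\<lambda>(v, w). Copy v w) (List.product vs1 vs2)"
      unfolding cs_def by (induction vs1) auto
    then show ?thesis
      using d1 d2 by (auto simp: distinct_map inj_on_def distinct_product)
  qed
  have dy: "distinct (ms @ cs)"
    using dms dcs sms scs by auto
  have dx: "distinct (xs @ ms @ cs)"
    using dy d1 sms scs by (auto simp: xs_def distinct_map inj_on_def)
  have sx: "set (xs @ ms @ cs) = set vs"
    unfolding d(2)
    by (auto simp: sms scs xs_def d1 subdivision_vertex_corona_def subdivision_digraph_def)
  have finV: "finite (pverts D1)" "finite (pverts D2)"
    using d1 d2 by (metis finite_set)+
  have sumy: "(\<Sum>s\<in>set (ms @ cs). f s) =
      (\<Sum>a\<in>parcs D1. f (Sub (Mid a))) + (\<Sum>v\<in>pverts D1. \<Sum>w\<in>pverts D2. f (Copy v w))"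
    for f :: "_ \<Rightarrow> complex poly fract"
  proof -
    have "(\<Sum>s\<in>set (ms @ cs). f s) = (\<Sum>s\<in>set ms. f s) + (\<Sum>s\<in>set cs. f s)"
      unfolding set_append by (rule sum.union_disjoint) (auto simp: sms scs fin finV)
    also have "(\<Sum>s\<in>set ms. f s) = (\<Sum>a\<in>parcs D1. f (Sub (Mid a)))"
      unfolding sms by (subst sum.reindex) (auto simp: inj_on_def)
    also have "(\<Sum>s\<in>set cs. f s) = (\<Sum>v\<in>pverts D1. \<Sum>w\<in>pverts D2. f (Copy v w))"
      unfolding scs by (subst sum.reindex) (auto simp: inj_on_def sum.cartesian_product intro!: sum.cong)
    finally show ?thesis .
  qed
  \<comment> \<open>Column \<open>v\<close> of \<open>X\<close> solves the system of the second block against the column of the original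
    vertex \<open>v\<close>. That column is \<open>- 1\<close> at the subdivision vertices of arcs into \<open>v\<close>, where the
    block is \<open>\<Lambda>\<close> times the identity, and \<open>- 1\<close> on the copy at \<open>v\<close>, where \<open>x\<close>
    solves the system with right-hand side all ones.\<close>
  define X :: "('a, 'b) corona_vertex \<Rightarrow> ('a, 'b) corona_vertex \<Rightarrow> complex poly fract" where
    "X s v = (case s of Sub (Mid a) \<Rightarrow> if v = Sub (Orig (snd a)) then - 1 / \<Lambda> else 0
                      | Copy u w \<Rightarrow> if v = Sub (Orig u) then - x w else 0
                      | _ \<Rightarrow> 0)" for s v
  have X: "(\<Sum>s\<in>set (ms @ cs). P y s * X s v) = P y v"
    if y: "y \<in> set (ms @ cs)" and v: "v \<in> set xs" for y v
  proof -
    obtain v0 where v0: "v = Sub (Orig v0)" "v0 \<in> pverts D1"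
      using v by (auto simp: xs_def d1)
    from y consider a where "y = Sub (Mid a)" "a \<in> parcs D1"
      | u w where "y = Copy u w" "u \<in> pverts D1" "w \<in> pverts D2"
      by (auto simp: sms scs)
    then show ?thesis
    proof cases
      case 1
      have "(\<Sum>b\<in>parcs D1. P y (Sub (Mid b)) * X (Sub (Mid b)) v) =
            (\<Sum>b\<in>parcs D1. if b = a then (if snd a = v0 then - 1 else 0) else 0)"
        by (rule sum.cong) (auto simp: 1 v0 P_def pencil_def X_def)
      also have "\<dots> = (if snd a = v0 then - 1 else 0)"
        using 1 fin by simp
      finally show ?thesis
        unfolding sumy using 1 by (auto simp: P_def pencil_def v0)
    next
      case 2
      have "(\<Sum>u'\<in>pverts D1. \<Sum>w'\<in>pverts D2. P y (Copy u' w') * X (Copy u' w') v) =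
            (\<Sum>u'\<in>pverts D1. if u' = u then (if u = v0 then - (\<Sum>w'\<in>pverts D2. pencil \<Lambda> D2 w w' * x w') else 0) else 0)"
        using 2 by (intro sum.cong) (auto simp: P_def pencil_def X_def v0 simp flip: sum_negf intro!: sum.cong)
      also have "\<dots> = (if u = v0 then - 1 else 0)"
        using 2 finV x1[of w] d2 by simp
      finally show ?thesis
        unfolding sumy using 2 by (auto simp: P_def pencil_def v0)
    qed
  qed
  have vs1_nth: "vs1 ! i \<in> pverts D1" if "i < length vs1" for i
    using that d1(2) nth_mem by blast
  define r where "r = \<Lambda> ^ 2 - \<Lambda> * \<chi>"
  have schur: "P (Sub (Orig u)) (Sub (Orig v)) - (\<Sum>s\<in>set (ms @ cs). P (Sub (Orig u)) s * X s (Sub (Orig v)))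
      = (1 / \<Lambda>) * pencil r D1 u v" if uv: "u \<in> pverts D1" "v \<in> pverts D1" for u v
  proof -
    have "(\<Sum>a\<in>parcs D1. P (Sub (Orig u)) (Sub (Mid a)) * X (Sub (Mid a)) (Sub (Orig v))) =
          (\<Sum>a\<in>parcs D1. if a = (u, v) then 1 / \<Lambda> else 0)"
      by (rule sum.cong) (auto simp: P_def pencil_def X_def)
    also have "\<dots> = (if (u, v) \<in> parcs D1 then 1 / \<Lambda> else 0)"
      using fin by simp
    finally have 1: "(\<Sum>a\<in>parcs D1. P (Sub (Orig u)) (Sub (Mid a)) * X (Sub (Mid a)) (Sub (Orig v))) = \<dots>" .
    have "(\<Sum>u'\<in>pverts D1. \<Sum>w\<in>pverts D2. P (Sub (Orig u)) (Copy u' w) * X (Copy u' w) (Sub (Orig v))) =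
          (\<Sum>u'\<in>pverts D1. if u' = u then (if u = v then (\<Sum>w\<in>pverts D2. x w) else 0) else 0)"
      using uv by (intro sum.cong) (auto simp: P_def pencil_def X_def intro!: sum.cong)
    also have "\<dots> = (if u = v then \<chi> else 0)"
      using uv finV x2 d2 by simp
    finally show ?thesis
      unfolding sumy 1 by (auto simp: P_def pencil_def r_def field_simps power2_eq_square)
  qed
  have "table_mat (\<lambda>u v. P u v - (\<Sum>s\<in>set (ms @ cs). P u s * X s v)) xs xs =
        (1 / \<Lambda>) \<cdot>\<^sub>m table_mat (pencil r D1) vs1 vs1"
    unfolding xs_def table_mat_map
    by (rule eq_matI) (simp_all del: set_append add: schur vs1_nth)
  then have detS: "det (table_mat (\<lambda>u v. P u v - (\<Sum>s\<in>set (ms @ cs). P u s * X s v)) xs xs) =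
      (1 / \<Lambda>) ^ card (pverts D1) * det (table_mat (pencil r D1) vs1 vs1)"
    by (simp add: len)
  have "det (table_mat P ms ms) = (\<Prod>a\<leftarrow>as. det (table_mat P [Sub (Mid a)] [Sub (Mid a)]))"
    unfolding ms_def by (rule det_table_mat_concat) (auto simp: as P_def pencil_def)
  also have "(\<lambda>a. det (table_mat P [Sub (Mid a)] [Sub (Mid a)])) = (\<lambda>a. \<Lambda>)"
    by (subst det_single) (auto simp: P_def pencil_def)
  finally have detM: "det (table_mat P ms ms) = \<Lambda> ^ card (parcs D1)"
    by (simp add: lena map_replicate_const)
  have "det (table_mat P cs cs) = (\<Prod>v\<leftarrow>vs1. det (table_mat P (map (Copy v) vs2) (map (Copy v) vs2)))"
    unfolding cs_def by (rule det_table_mat_concat) (auto simp: d1 P_def pencil_def)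
  also have "map (\<lambda>v. det (table_mat P (map (Copy v) vs2) (map (Copy v) vs2))) vs1 =
      map (\<lambda>v. det (table_mat (pencil \<Lambda> D2) vs2 vs2)) vs1"
    by (intro map_cong arg_cong[of _ _ det] refl, unfold table_mat_map)
       (auto simp: P_def pencil_def d1 intro!: table_mat_cong)
  finally have detC: "det (table_mat P cs cs) = det (table_mat (pencil \<Lambda> D2) vs2 vs2) ^ card (pverts D1)"
    by (simp add: len map_replicate_const)
  have "det (table_mat P (ms @ cs) (ms @ cs)) = det (table_mat P ms ms) * det (table_mat P cs cs)"
    by (rule det_table_mat_append) (auto simp: sms scs P_def pencil_def)
  note detY = this[unfolded detM detC]
  have "to_fract (char_poly (adjacency_matrix (D1 \<odot> D2) vs)) = det (table_mat P vs vs)"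
    unfolding P_def poly_subst_char_poly[OF d(1), symmetric] by (rule poly_subst_var[symmetric])
  also have "\<dots> = det (table_mat P (xs @ ms @ cs) (xs @ ms @ cs))"
    by (rule det_table_mat_reorder) (use d dx sx in auto)
  also have "\<dots> =
      det (table_mat (\<lambda>u v. P u v - (\<Sum>s\<in>set (ms @ cs). P u s * X s v)) xs xs) *
      det (table_mat P (ms @ cs) (ms @ cs))"
    using dy X by (rule det_table_mat_schur)
  also have "\<dots> = (1 / \<Lambda>) ^ card (pverts D1) * det (table_mat (pencil r D1) vs1 vs1) *
      (\<Lambda> ^ card (parcs D1) * det (table_mat (pencil \<Lambda> D2) vs2 vs2) ^ card (pverts D1))"
    unfolding detS detY ..
  also have "\<Lambda> ^ card (pverts D1) * \<dots> =
      (\<Lambda> * (1 / \<Lambda>)) ^ card (pverts D1) * (\<Lambda> ^ card (parcs D1) *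
        det (table_mat (pencil \<Lambda> D2) vs2 vs2) ^ card (pverts D1) * det (table_mat (pencil r D1) vs1 vs1))"
    by (simp only: power_mult_distrib mult_ac)
  also have "\<Lambda> * (1 / \<Lambda>) = 1"
    by simp
  also have "det (table_mat (pencil \<Lambda> D2) vs2 vs2) = to_fract (char_poly (adjacency_matrix D2 vs2))"
    unfolding poly_subst_char_poly[OF d2(1), symmetric] by (rule poly_subst_var)
  also have "det (table_mat (pencil r D1) vs1 vs1) =
      poly_subst (char_poly (adjacency_matrix D1 vs1)) (\<Lambda> ^ 2 - \<Lambda> * coronal (adjacency_matrix D2 vs2))"
    unfolding r_def \<chi>_def by (rule poly_subst_char_poly[OF d1(1), symmetric])
  finally show ?thesis
    by (simp only: power_one mult_1_left)
qed

section \<open>The spectrum of the corona\<close>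

lemma A_spectrum_char_poly:
  "(\<Prod>z\<in>#A_spectrum D vs. [:- z, 1:]) = char_poly (adjacency_matrix D vs)"
  using complex_poly_decompose_multiset[of "char_poly (adjacency_matrix D vs)"]
    degree_monic_char_poly[OF adjacency_matrix_carrier[of D vs]]
  by (simp add: A_spectrum_def)

lemma size_A_spectrum: "size (A_spectrum D vs) = length vs"
  using degree_monic_char_poly[OF adjacency_matrix_carrier[of D vs]]
  by (simp add: A_spectrum_def size_proots_complex)

text \<open>
  The identity of \<open>char_poly_corona\<close> is compared for both coronas. The characteristic polynomials
  of the factors are recovered from their spectra, and the number of vertices of the first factor
  is the size of its spectrum. Adding zeros on both sides expresses that the two characteristic
  polynomials agree after multiplication with suitable powers of the indeterminate.
\<close>

lemma corona_spectrum:
  fixes D1 :: "'a pair_pre_digraph" and D2 :: "'b pair_pre_digraph"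
    and D1' :: "'c pair_pre_digraph" and D2' :: "'d pair_pre_digraph"
  assumes fin: "finite (parcs D1)" and fin': "finite (parcs D1')"
    and vs: "vertex_enum D1 vs1" "vertex_enum D2 vs2" "vertex_enum (D1 \<odot> D2) vs"
    and vs': "vertex_enum D1' vs1'" "vertex_enum D2' vs2'" "vertex_enum (D1' \<odot> D2') vs'"
    and sp: "A_spectrum D1' vs1' = A_spectrum D1 vs1" "A_spectrum D2' vs2' = A_spectrum D2 vs2"
    and cor: "coronal (adjacency_matrix D2' vs2') = coronal (adjacency_matrix D2 vs2)"
  shows "replicate_mset (card (parcs D1)) 0 + A_spectrum (D1' \<odot> D2') vs' =
         replicate_mset (card (parcs D1')) 0 + A_spectrum (D1 \<odot> D2) vs"
proof -
  have cp: "char_poly (adjacency_matrix D1' vs1') = char_poly (adjacency_matrix D1 vs1)"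
      "char_poly (adjacency_matrix D2' vs2') = char_poly (adjacency_matrix D2 vs2)"
    using sp by (metis A_spectrum_char_poly)+
  have n: "card (pverts D1') = card (pverts D1)"
    using arg_cong[OF sp(1), of size] vs(1) vs'(1)
    by (simp add: size_A_spectrum vertex_enum_def) (metis distinct_card)
  let ?f = "char_poly (adjacency_matrix (D1 \<odot> D2) vs)"
  let ?f' = "char_poly (adjacency_matrix (D1' \<odot> D2') vs')"
  let ?m = "card (parcs D1)" and ?m' = "card (parcs D1')"
  let ?X = "[:0, 1:] :: complex poly"
  have "\<Lambda> ^ card (pverts D1) * (\<Lambda> ^ ?m * to_fract ?f') =
        \<Lambda> ^ card (pverts D1) * (\<Lambda> ^ ?m' * to_fract ?f)"
    unfolding mult.left_commute[of "\<Lambda> ^ card (pverts D1)"]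
    unfolding char_poly_corona[OF fin vs] char_poly_corona[OF fin' vs', unfolded cp n cor]
    by (simp only: mult_ac)
  then have "\<Lambda> ^ ?m * to_fract ?f' = \<Lambda> ^ ?m' * to_fract ?f"
    by simp
  moreover have \<Lambda>_power: "\<Lambda> ^ k = to_fract (?X ^ k)" for k
    by (induction k) (simp_all only: ratfun_var_def power_0 power_Suc to_fract_1 to_fract_mult)
  ultimately have "to_fract (?X ^ ?m * ?f') = to_fract (?X ^ ?m' * ?f)"
    unfolding \<Lambda>_power to_fract_mult by blast
  then have "?X ^ ?m * ?f' = ?X ^ ?m' * ?f"
    by (simp only: to_fract_eq_iff)
  then have "proots (?X ^ ?m * ?f') = proots (?X ^ ?m' * ?f)"
    by simp
  moreover have "repeat_mset k {#0#} = replicate_mset k (0 :: complex)" for k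
    by (rule multiset_eqI) simp
  ultimately show ?thesis
    by (simp add: proots_mult proots_power char_poly_nz A_spectrum_def)
qed

lemma finite_arcs:
  assumes "nonempty_digraph D"
  shows "finite (parcs D)"
proof -
  interpret pair_digraph D
    using assms by (simp add: nonempty_digraph_def)
  show ?thesis
    by (rule pair_finite_arcs)
qed

theorem theorem5p2:
  fixes D1 :: "'a pair_pre_digraph" and D2 :: "'b pair_pre_digraph"
    and n1 n2 m1 m2 :: nat
    and vs1 :: "'a list" and vs2 :: "'b list" and vs :: "('a, 'b) corona_vertex list"
  assumes "nonempty_digraph D1" and "nonempty_digraph D2"
    and "card (pverts D1) = n1" and "card (parcs D1) = m1"
    and "card (pverts D2) = n2" and "card (parcs D2) = m2"
    and "vertex_enum D1 vs1" and "vertex_enum D2 vs2" and "vertex_enum (D1 \<odot> D2) vs"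
  shows
    "to_fract (char_poly (adjacency_matrix (D1 \<odot> D2) vs)) =
       \<Lambda> powi (int m1 - int n1)
       * to_fract (char_poly (adjacency_matrix D2 vs2)) ^ n1
       * poly_subst (char_poly (adjacency_matrix D1 vs1))
           (\<Lambda> ^ 2 - \<Lambda> * coronal (adjacency_matrix D2 vs2))
     \<and> (\<forall>(D1' :: 'c pair_pre_digraph) (D2' :: 'd pair_pre_digraph) vs1' vs2' vs'.
          nonempty_digraph D1' \<and> nonempty_digraph D2'
          \<and> vertex_enum D1' vs1' \<and> vertex_enum D2' vs2' \<and> vertex_enum (D1' \<odot> D2') vs'
          \<and> A_spectrum D1' vs1' = A_spectrum D1 vs1
          \<and> A_spectrum D2' vs2' = A_spectrum D2 vs2
          \<and> coronal (adjacency_matrix D2' vs2') = coronal (adjacency_matrix D2 vs2)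
          \<longrightarrow> filter_mset (\<lambda>z. z \<noteq> 0) (A_spectrum (D1' \<odot> D2') vs')
                = filter_mset (\<lambda>z. z \<noteq> 0) (A_spectrum (D1 \<odot> D2) vs)
            \<and> (card (parcs D1') = m1
                \<longrightarrow> A_spectrum (D1' \<odot> D2') vs' = A_spectrum (D1 \<odot> D2) vs))"
proof (rule conjI, goal_cases)
  case 1
  show ?case
    using char_poly_corona[OF finite_arcs[OF assms(1)] assms(7,8,9)] assms(3,4)
    by (simp add: power_int_diff field_simps)
next
  case 2
  show ?case
  proof (intro allI impI, elim conjE, goal_cases)
    case (1 D1' D2' vs1' vs2' vs')
    have eq: "replicate_mset m1 0 + A_spectrum (D1' \<odot> D2') vs' =
              replicate_mset (card (parcs D1')) 0 + A_spectrum (D1 \<odot> D2) vs"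
      using corona_spectrum[OF finite_arcs[OF assms(1)] finite_arcs[OF 1(1)] assms(7,8,9) 1(3-8)] assms(4)
      by simp
    have "filter_mset (\<lambda>z. z \<noteq> 0) (replicate_mset k (0 :: complex)) = {#}" for k
      by (induction k) auto
    then have "filter_mset (\<lambda>z. z \<noteq> 0) (A_spectrum (D1' \<odot> D2') vs') =
               filter_mset (\<lambda>z. z \<noteq> 0) (A_spectrum (D1 \<odot> D2) vs)"
      using arg_cong[OF eq, of "filter_mset (\<lambda>z. z \<noteq> 0)"] by (simp only: filter_union_mset add_0)
    with eq show ?case
      by auto
  qed
qed

end
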